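(* Let $(X,d)$ be a metric space, let $C(X)$ be the collection of nonempty closed subsets of $X$, and let $H$ be the Hausdorff metric on $C(X)$. Then $X$ has the property $Q$ if and only if $(C(X),H)$ has the property $Q$.
   Context: The Hausdorff metric on $C(X)$ is $H(A,B)=\max\{\sup_{x\in A}d(x,B),\ \sup_{x\in B}d(x,A)\}$, where $d(x,B)=\inf\{d(x,y):y\in B\}$ ($H$ may take the value $+\infty$). For a nonempty subset $A$ of a (possibly extended-valued) metric space $(Y,\rho)$, put $\gamma(A)=\inf\{\epsilon>0:\text{ the set }\{a\in A:\rho(a,A\setminus\{a\})>\epsilon\}\text{ is finite}\}$; equivalently, $\gamma(A)=\sup\{\epsilon>0: \{a\in A:\rho(a,A\setminus\{a\})>\epsilon\}\text{ is infinite}\}$, with $\gamma(A)=0$ if there is no such $\epsilon$. The set $A$ has the property $Q$ if $\gamma(A)=0$, i.e., for every $\epsilon>0$ the set $\{a\in A:\rho(a,A\setminus\{a\})>\epsilon\}$ is finite. The space $Y$ has the property $Q$ if this holds with $A=Y$. *)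

theory Defs
  imports "HOL-Analysis.Analysis"
begin

text \<open>
  Extended metrics are functions into \<^typ>\<open>ennreal\<close>, restricted to a carrier set.
  The distance from a point to the empty set is \<open>\<infinity>\<close>, in contrast to the
  library's real-valued \<^const>\<open>infdist\<close>, for which it is 0.
\<close>

definition pt_set_dist :: "('a \<Rightarrow> 'a \<Rightarrow> ennreal) \<Rightarrow> 'a \<Rightarrow> 'a set \<Rightarrow> ennreal" where
  "pt_set_dist \<rho> x B = (INF y\<in>B. \<rho> x y)"

definition hausdorff_dist :: "('a \<Rightarrow> 'a \<Rightarrow> ennreal) \<Rightarrow> 'a set \<Rightarrow> 'a set \<Rightarrow> ennreal" where
  "hausdorff_dist \<rho> A B = max (SUP x\<in>A. pt_set_dist \<rho> x B) (SUP x\<in>B. pt_set_dist \<rho> x A)"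

definition nonempty_closed_sets :: "'a set \<Rightarrow> ('a \<Rightarrow> 'a \<Rightarrow> real) \<Rightarrow> 'a set set" where
  "nonempty_closed_sets X d = {A. A \<noteq> {} \<and> closedin (Metric_space.mtopology X d) A}"

definition gamma_index :: "('a \<Rightarrow> 'a \<Rightarrow> ennreal) \<Rightarrow> 'a set \<Rightarrow> ennreal" where
  "gamma_index \<rho> A =
     Inf {ennreal \<epsilon> | \<epsilon>. \<epsilon> > 0 \<and> finite {a \<in> A. pt_set_dist \<rho> a (A - {a}) > ennreal \<epsilon>}}"

definition property_Q :: "('a \<Rightarrow> 'a \<Rightarrow> ennreal) \<Rightarrow> 'a set \<Rightarrow> bool" where
  "property_Q \<rho> A \<longleftrightarrow> gamma_index \<rho> A = 0"

lemma property_Q_iff: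
  "property_Q \<rho> A \<longleftrightarrow>
     (\<forall>\<epsilon>::real. \<epsilon> > 0 \<longrightarrow> finite {a \<in> A. pt_set_dist \<rho> a (A - {a}) > ennreal \<epsilon>})"
  (is "_ \<longleftrightarrow> (\<forall>\<epsilon>. _ \<longrightarrow> finite (?I \<epsilon>))")
proof
  assume "property_Q \<rho> A"
  then have Q: "Inf {ennreal \<epsilon> | \<epsilon>. \<epsilon> > 0 \<and> finite (?I \<epsilon>)} = 0"
    unfolding property_Q_def gamma_index_def .
  show "\<forall>\<epsilon>::real. \<epsilon> > 0 \<longrightarrow> finite (?I \<epsilon>)"
  proof (intro allI impI)
    fix \<epsilon> :: real assume "\<epsilon> > 0"
    then have "0 < ennreal \<epsilon>" by simp
    then have "Inf {ennreal \<epsilon> | \<epsilon>. \<epsilon> > 0 \<and> finite (?I \<epsilon>)} < ennreal \<epsilon>"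
      unfolding Q .
    then obtain \<delta> where \<delta>: "finite (?I \<delta>)" "ennreal \<delta> < ennreal \<epsilon>"
      unfolding Inf_less_iff by blast
    have "?I \<epsilon> \<subseteq> ?I \<delta>"
      using less_trans[OF \<delta>(2)] by (intro Collect_mono) blast
    then show "finite (?I \<epsilon>)" using \<delta>(1) by (rule finite_subset)
  qed
next
  assume F: "\<forall>\<epsilon>::real. \<epsilon> > 0 \<longrightarrow> finite (?I \<epsilon>)"
  have "gamma_index \<rho> A \<le> 0 + ennreal \<epsilon>" if "\<epsilon> > 0" for \<epsilon>
  proof -
    have "ennreal \<epsilon> \<in> {ennreal \<epsilon> | \<epsilon>. \<epsilon> > 0 \<and> finite (?I \<epsilon>)}"
      using F that by blast
    then have "gamma_index \<rho> A \<le> ennreal \<epsilon>"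
      unfolding gamma_index_def by (rule Inf_lower)
    then show ?thesis by (simp only: add_0)
  qed
  then have "gamma_index \<rho> A \<le> 0" by (rule ennreal_le_epsilon)
  then show "property_Q \<rho> A" unfolding property_Q_def by (simp only: le_zero_eq)
qed

end

theory Submission imports Defs begin

text \<open>
  If a closed set \<open>A\<close> contains a point \<open>a\<close> that has a distinct point \<open>b\<close> nearby, then \<open>A\<close> has a
  Hausdorff neighbour as well: add \<open>b\<close> to \<open>A\<close> if \<open>b \<notin> A\<close>, and otherwise delete from \<open>A\<close> the open
  ball around \<open>a\<close> of radius \<open>d a b\<close>. Hence an isolated element of the hyperspace consists of isolated
  points, and a finite set has only finitely many subsets. Conversely, the singleton of an isolated
  point is isolated in the hyperspace, with at least the same distance to the rest.
\<close>

lemma hausdorff_dist_le: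
  assumes "\<And>x. x \<in> A \<Longrightarrow> \<exists>y\<in>B. \<rho> x y \<le> c" and "\<And>x. x \<in> B \<Longrightarrow> \<exists>y\<in>A. \<rho> x y \<le> c"
  shows "hausdorff_dist \<rho> A B \<le> c"
  unfolding hausdorff_dist_def pt_set_dist_def
  by (intro max.boundedI SUP_least) (meson assms INF_lower2)+

lemma pt_set_dist_less_iff: "pt_set_dist \<rho> x B < c \<longleftrightarrow> (\<exists>y\<in>B. \<rho> x y < c)"
  unfolding pt_set_dist_def by (rule INF_less_iff)

lemma pt_set_dist_le: "y \<in> B \<Longrightarrow> pt_set_dist \<rho> x B \<le> \<rho> x y"
  unfolding pt_set_dist_def by (rule INF_lower)

context Metric_space
begin

text \<open>The point \<open>b\<close> ranges over all of \<open>M\<close>, because isolation of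
  \<open>a\<close> is measured in the whole space and not inside \<open>A\<close>. This forces the
  split on \<open>b \<in> A\<close>.\<close>

lemma closed_set_near:
  assumes A: "A \<in> nonempty_closed_sets M d" and "a \<in> A" "b \<in> M" "a \<noteq> b"
  obtains B where "B \<in> nonempty_closed_sets M d" "B \<noteq> A"
    "hausdorff_dist (\<lambda>x y. ennreal (d x y)) A B \<le> ennreal (2 * d a b)"
proof -
  have clA: "closedin mtopology A"
    using A by (simp add: nonempty_closed_sets_def)
  have AM: "A \<subseteq> M"
    using closedin_subset[OF clA] by simp
  with \<open>a \<in> A\<close> have "a \<in> M" by blast
  have pos: "0 < d a b"
    using \<open>a \<in> M\<close> \<open>b \<in> M\<close> \<open>a \<noteq> b\<close> by simp
  show ?thesis
  proof (cases "b \<in> A")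
    case False
    show ?thesis
    proof
      have "closedin mtopology {b}"
        using \<open>b \<in> M\<close> by (simp add: closedin_t1_singleton t1_space_mtopology)
      then show "insert b A \<in> nonempty_closed_sets M d"
        using closedin_Un[OF _ clA, of "{b}"] by (simp add: nonempty_closed_sets_def)
      show "insert b A \<noteq> A"
        using False by blast
      \<comment> \<open>Points of \<open>A\<close> lie in both sets and are their own witnesses;
        only the added \<open>b\<close> needs another one, namely \<open>a\<close>.\<close>
      have self: "ennreal (d x x) \<le> ennreal (2 * d a b)" if "x \<in> A" for x
        using that AM pos by auto
      have "ennreal (d b a) \<le> ennreal (2 * d a b)"
        using pos by (simp add: commute ennreal_leI)
      then show "hausdorff_dist (\<lambda>x y. ennreal (d x y)) A (insert b A) \<le> ennreal (2 * d a b)"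
        using self \<open>a \<in> A\<close> by (intro hausdorff_dist_le) blast+
    qed
  next
    case True
    \<comment> \<open>Deleting \<open>a\<close> alone could leave a set that is not closed. The open
      ball of radius exactly \<open>d a b\<close> misses \<open>b\<close>, so \<open>?B\<close>
      stays nonempty.\<close>
    let ?B = "A - mball a (d a b)"
    have "b \<in> ?B"
      using True by simp
    show ?thesis
    proof
      show "?B \<in> nonempty_closed_sets M d"
        using clA \<open>b \<in> ?B\<close> by (auto simp: nonempty_closed_sets_def intro!: closedin_diff)
      show "?B \<noteq> A"
        using \<open>a \<in> A\<close> \<open>a \<in> M\<close> pos by auto
      show "hausdorff_dist (\<lambda>x y. ennreal (d x y)) A ?B \<le> ennreal (2 * d a b)"
      proof (rule hausdorff_dist_le)
        fix x assume "x \<in> A"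
        then have "x \<in> M" using AM by blast
        show "\<exists>y\<in>?B. ennreal (d x y) \<le> ennreal (2 * d a b)"
        proof (cases "x \<in> ?B")
          case True
          then show ?thesis using \<open>x \<in> M\<close> by (intro bexI[of _ x]) auto
        next
          case False
          \<comment> \<open>The factor 2 arises here: a deleted point reaches the surviving
            \<open>b\<close> by way of \<open>a\<close>.\<close>
          then have "d a x < d a b" using \<open>x \<in> A\<close> by simp
          then have "d x b \<le> 2 * d a b"
            using triangle[OF \<open>x \<in> M\<close> \<open>a \<in> M\<close> \<open>b \<in> M\<close>] by (simp add: commute)
          then show ?thesis using \<open>b \<in> ?B\<close> ennreal_leI by blast
        qed
      next
        fix x assume "x \<in> ?B"
        then show "\<exists>y\<in>A. ennreal (d x y) \<le> ennreal (2 * d a b)"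
          using AM by (intro bexI[of _ x]) auto
      qed
    qed
  qed
qed

lemma isolated_closed_set_subset:
  assumes "\<epsilon> > 0" and A: "A \<in> nonempty_closed_sets M d"
    and iso: "pt_set_dist (hausdorff_dist (\<lambda>x y. ennreal (d x y))) A
                (nonempty_closed_sets M d - {A}) > ennreal \<epsilon>"
  shows "A \<subseteq> {a \<in> M. pt_set_dist (\<lambda>x y. ennreal (d x y)) a (M - {a}) > ennreal (\<epsilon> / 3)}"
proof
  fix a assume "a \<in> A"
  then have "a \<in> M"
    using A closedin_subset[of mtopology A] by (auto simp: nonempty_closed_sets_def)
  moreover have False
    if "pt_set_dist (\<lambda>x y. ennreal (d x y)) a (M - {a}) \<le> ennreal (\<epsilon> / 3)"
  proof -
    \<comment> \<open>The infimum need not be attained, so slack between the two bounds is used to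
      extract an actual \<open>b\<close>. If \<open>M - {a}\<close> is empty, the distance is
      infinite and the assumed bound fails.\<close>
    have "ennreal (\<epsilon> / 3) < ennreal (\<epsilon> / 2)"
      using \<open>\<epsilon> > 0\<close> by (simp add: ennreal_lessI)
    with that have "pt_set_dist (\<lambda>x y. ennreal (d x y)) a (M - {a}) < ennreal (\<epsilon> / 2)"
      by (rule le_less_trans)
    then obtain b where b: "b \<in> M" "a \<noteq> b" "ennreal (d a b) < ennreal (\<epsilon> / 2)"
      unfolding pt_set_dist_less_iff by blast
    then have "ennreal (2 * d a b) \<le> ennreal \<epsilon>"
      by (intro ennreal_leI) (simp add: ennreal_less_iff)
    obtain B where B: "B \<in> nonempty_closed_sets M d" "B \<noteq> A"
      "hausdorff_dist (\<lambda>x y. ennreal (d x y)) A B \<le> ennreal (2 * d a b)"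
      using closed_set_near[OF A \<open>a \<in> A\<close> b(1,2)] .
    have "pt_set_dist (hausdorff_dist (\<lambda>x y. ennreal (d x y))) A (nonempty_closed_sets M d - {A})
        \<le> hausdorff_dist (\<lambda>x y. ennreal (d x y)) A B"
      using B by (intro pt_set_dist_le) blast
    also have "\<dots> \<le> ennreal \<epsilon>"
      using B(3) \<open>ennreal (2 * d a b) \<le> ennreal \<epsilon>\<close> by (rule order_trans)
    finally show False using iso by simp
  qed
  ultimately show "a \<in> {a \<in> M. pt_set_dist (\<lambda>x y. ennreal (d x y)) a (M - {a}) > ennreal (\<epsilon> / 3)}"
    by (auto simp: not_le[symmetric])
qed

text \<open>A nonempty \<open>B\<close> other than \<open>{x}\<close> contains some
  \<open>y \<noteq> x\<close>, and the only point of \<open>{x}\<close> near which \<open>y\<close>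
  could lie is \<open>x\<close> itself, so \<open>B\<close> is at least \<open>d x y\<close> away
  from \<open>{x}\<close>.\<close>

lemma pt_set_dist_singleton_ge:
  assumes "x \<in> M"
  shows "pt_set_dist (\<lambda>x y. ennreal (d x y)) x (M - {x})
    \<le> pt_set_dist (hausdorff_dist (\<lambda>x y. ennreal (d x y))) {x} (nonempty_closed_sets M d - {{x}})"
  unfolding pt_set_dist_def[of "hausdorff_dist _"]
proof (rule INF_greatest)
  fix B assume B: "B \<in> nonempty_closed_sets M d - {{x}}"
  then obtain y where y: "y \<in> B" "y \<noteq> x"
    by (auto simp: nonempty_closed_sets_def)
  moreover have "B \<subseteq> M"
    using B closedin_subset[of mtopology B] by (auto simp: nonempty_closed_sets_def)
  ultimately have "pt_set_dist (\<lambda>x y. ennreal (d x y)) x (M - {x}) \<le> ennreal (d x y)"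
    by (intro pt_set_dist_le) blast
  also have "\<dots> = pt_set_dist (\<lambda>x y. ennreal (d x y)) y {x}"
    by (simp add: pt_set_dist_def commute)
  also have "\<dots> \<le> (SUP y\<in>B. pt_set_dist (\<lambda>x y. ennreal (d x y)) y {x})"
    using y(1) by (rule SUP_upper)
  also have "\<dots> \<le> hausdorff_dist (\<lambda>x y. ennreal (d x y)) {x} B"
    unfolding hausdorff_dist_def by (rule max.cobounded2)
  finally show "pt_set_dist (\<lambda>x y. ennreal (d x y)) x (M - {x})
    \<le> hausdorff_dist (\<lambda>x y. ennreal (d x y)) {x} B" .
qed

end

theorem theorem4p1:
  fixes X :: "'a set" and d :: "'a \<Rightarrow> 'a \<Rightarrow> real"
  assumes "Metric_space X d"
  shows "property_Q (\<lambda>x y. ennreal (d x y)) X \<longleftrightarrow>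
         property_Q (hausdorff_dist (\<lambda>x y. ennreal (d x y))) (nonempty_closed_sets X d)"
proof -
  interpret Metric_space X d by (fact assms)
  let ?I = "\<lambda>\<epsilon>. {a \<in> X. pt_set_dist (\<lambda>x y. ennreal (d x y)) a (X - {a}) > ennreal \<epsilon>}"
  let ?J = "\<lambda>\<epsilon>. {A \<in> nonempty_closed_sets X d.
    pt_set_dist (hausdorff_dist (\<lambda>x y. ennreal (d x y))) A (nonempty_closed_sets X d - {A})
      > ennreal \<epsilon>}"
  have "finite (?J \<epsilon>)" if "\<epsilon> > 0" "finite (?I (\<epsilon> / 3))" for \<epsilon>
  proof (rule finite_subset)
    show "?J \<epsilon> \<subseteq> Pow (?I (\<epsilon> / 3))"
      using isolated_closed_set_subset[OF that(1)] by blast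
  qed (use that(2) in simp)
  moreover have "finite (?I \<epsilon>)" if "finite (?J \<epsilon>)" for \<epsilon>
  proof -
    have "{x} \<in> nonempty_closed_sets X d" if "x \<in> X" for x
      using that by (simp add: nonempty_closed_sets_def closedin_t1_singleton t1_space_mtopology)
    \<comment> \<open>This direction keeps the same \<open>\<epsilon>\<close>, since passing to
      singletons does not decrease the distance to the rest.\<close>
    then have "(\<lambda>x. {x}) ` ?I \<epsilon> \<subseteq> ?J \<epsilon>"
      using less_le_trans[OF _ pt_set_dist_singleton_ge] by blast
    then have "finite ((\<lambda>x. {x}) ` ?I \<epsilon>)"
      using that by (rule finite_subset)
    then show ?thesis
      by (rule finite_imageD) simp
  qed
  ultimately show ?thesis
    \<comment> \<open>The loss from \<open>\<epsilon>\<close> to \<open>\<epsilon> / 3\<close> is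
      harmless because property Q quantifies over all positive thresholds.\<close>
    unfolding property_Q_iff by (meson divide_pos_pos zero_less_numeral)
qed

end
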